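(* Let $n\ge 1$, let $\pi\in\mathcal{S}_n$ and let $\Lambda=\Lambda(\pi)$ be its associated partition. Then (i) the number of different nonzero parts of $\Lambda$ equals $\mathrm{des}(\pi)$; (ii) the number of nonzero parts of $\Lambda$ equals $n-\mathrm{lrmax}(\pi)$; (iii) the largest part of $\Lambda$ equals the largest descent of $\pi$; (iv) the sum of all different parts of $\Lambda$ (each distinct value counted once) equals $\mathrm{maj}(\pi)$; (v) the sum of all parts (equivalently, the area) of $\Lambda$ equals $\mathrm{lbsum}(\pi)$.
   Context: $\mathcal{S}_n$ is the set of permutations $\pi=\pi_1\cdots\pi_n$ of $[n]=\{1,\ldots,n\}$, written as words. The standardization $w^{\ast}$ of a word $w$ of $m$ distinct positive integers is the permutation in $\mathcal{S}_m$ obtained by replacing the $i$th smallest letter by $i$. The map $D$ from permutations in $\mathcal{S}_n$ to Dyck words of length $2n$ in the letters $\mathsf{u}$ (up step $(0,1)$) and $\mathsf{r}$ (right step $(1,0)$) is defined recursively by $D(\emptyset)=\emptyset$ and, for $\pi=\pi_L\,n\,\pi_R\in\mathcal{S}_n$ with $n\ge1$ ($\pi_L,\pi_R$ the possibly empty words to the left and right of the letter $n$), $D(\pi)=\mathsf{u}\,D(\pi_L^{\ast})\,\mathsf{r}\,D(\pi_R^{\ast})$. $\Lambda(\pi)$ is the partition with exactly $n-1$ parts (parts equal to $0$ allowed) whose Young diagram is the region above the path $D(\pi)$ drawn from $(0,0)$ to $(n,n)$. Equivalently, the parts of $\Lambda(\pi)$ are, in weakly decreasing order, the numbers of letters $\mathsf{r}$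 preceding the 2nd, 3rd, ..., $n$th letter $\mathsf{u}$ in $D(\pi)$. A descent of $\pi$ is an index $i\in[n-1]$ with $\pi_i>\pi_{i+1}$; $\mathrm{des}(\pi)$ is the number of descents and $\mathrm{maj}(\pi)$ is the sum of all descents. $\mathrm{lrmax}(\pi)$ is the number of left-to-right maxima, i.e. elements $\pi_i$ greater than all elements to their left. The left border number $a_i$ of $\pi$ is the largest position $m<i$ with $\pi_m>\pi_i$, or $0$ if no such position exists, and $\mathrm{lbsum}(\pi)=a_1+\cdots+a_n$. By convention the largest descent of a permutation without descents is $0$, and the largest part of an empty partition is $0$. *)

theory Defs
  imports Main "HOL-Combinatorics.Multiset_Permutations"
begin

text \<open>
  A permutation of \<open>[n]\<close> is its word, i.e. a list in \<^term>\<open>permutations_of_set {1..n}\<close>.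
  Positions in words are counted from 1, as opposed to list indices.
\<close>

definition letter :: "nat list \<Rightarrow> nat \<Rightarrow> nat" where
  "letter p i = p ! (i - 1)"

definition standardization :: "nat list \<Rightarrow> nat list" where
  "standardization w = map (\<lambda>x. card {y \<in> set w. y \<le> x}) w"

lemma length_standardization [simp]: "length (standardization w) = length w"
  by (simp add: standardization_def)

datatype step = Up | Rt

text \<open>
  Splitting at the maximal letter makes the recursion terminate on all lists; the maximal letter of
  a permutation of \<open>[n]\<close> is \<open>n\<close> (see \<open>dyck_perm\<close> below).
\<close>

function dyck :: "nat list \<Rightarrow> step list" where
  "dyck p = (if p = [] then [] else
     Up # dyck (standardization (takeWhile (\<lambda>x. x \<noteq> Max (set p)) p))
       @ Rt # dyck (standardization (tl (dropWhile (\<lambda>x. x \<noteq> Max (set p)) p))))"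
  by auto
termination
proof (relation "measure length", goal_cases)
  case 1
  show ?case by simp
next
  case (2 p)
  have "Max (set p) \<in> set p"
    using 2 by (intro Max_in) auto
  hence "takeWhile (\<lambda>x. x \<noteq> Max (set p)) p \<noteq> p"
    by (metis set_takeWhileD)
  hence "length (takeWhile (\<lambda>x. x \<noteq> Max (set p)) p) \<noteq> length p"
    by (metis takeWhile_eq_take take_all_iff order_refl)
  with length_takeWhile_le[of "\<lambda>x. x \<noteq> Max (set p)" p] show ?case
    by simp
next
  case (3 p)
  have "length (dropWhile (\<lambda>x. x \<noteq> Max (set p)) p) \<le> length p"
    by (rule length_dropWhile_le)
  moreover have "0 < length p"
    using 3 by simp
  ultimately have "length (dropWhile (\<lambda>x. x \<noteq> Max (set p)) p) - 1 < length p"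
    by linarith
  thus ?case
    by simp
qed

declare dyck.simps [simp del]

lemma dyck_Nil: "dyck [] = []"
  by (simp add: dyck.simps)

lemma dyck_perm:
  assumes "l @ n # r \<in> permutations_of_set {1..n}"
  shows "dyck (l @ n # r) = Up # dyck (standardization l) @ Rt # dyck (standardization r)"
proof -
  from assms have s: "set (l @ n # r) = {1..n}" and d: "distinct (l @ n # r)"
    by (simp_all add: permutations_of_set_def)
  have "n \<in> {1..n}"
    unfolding s[symmetric] by simp
  hence m: "Max (set (l @ n # r)) = n"
    unfolding s by (intro Max_eqI) auto
  have l: "\<And>x. x \<in> set l \<Longrightarrow> x \<noteq> n"
    using d by auto
  show ?thesis
    by (subst dyck.simps) (simp only: m, simp add: l)
qed

text \<open>
  The region above the path has one row to the left of each up step, whose length is the number of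
  right steps preceding it.  The row of the first up step is always empty and is not a part.
  The parts are listed in weakly decreasing order.
\<close>

definition partition_above :: "step list \<Rightarrow> nat list" where
  "partition_above w =
     rev (tl (map (\<lambda>k. count_list (take k w) Rt) (filter (\<lambda>k. w ! k = Up) [0..<length w])))"

definition Lam :: "nat list \<Rightarrow> nat list" where
  "Lam p = partition_above (dyck p)"

definition largest_part :: "nat list \<Rightarrow> nat" where
  "largest_part ps = Max (insert 0 (set ps))"

definition descents :: "nat list \<Rightarrow> nat set" where
  "descents p = {i \<in> {1..<length p}. letter p i > letter p (i + 1)}"

definition des :: "nat list \<Rightarrow> nat" where
  "des p = card (descents p)"

definition maj :: "nat list \<Rightarrow> nat" where
  "maj p = \<Sum>(descents p)"

definition largest_descent :: "nat list \<Rightarrow> nat" where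
  "largest_descent p = Max (insert 0 (descents p))"

definition lrmax :: "nat list \<Rightarrow> nat" where
  "lrmax p = card {i \<in> {1..length p}. \<forall>j \<in> {1..<i}. letter p j < letter p i}"

text \<open>Adjoining 0, which is not a position, gives the value 0 when there is no larger letter to the
  left.\<close>

definition left_border :: "nat list \<Rightarrow> nat \<Rightarrow> nat" where
  "left_border p i = Max (insert 0 {m \<in> {1..<i}. letter p m > letter p i})"

definition lbsum :: "nat list \<Rightarrow> nat" where
  "lbsum p = (\<Sum>i = 1..length p. left_border p i)"

end

theory Submission
  imports Defs
begin

text \<open>
  Left border numbers obey the recursion that defines \<^const>\<open>dyck\<close>: splitting a permutation at its
  maximum, which sits at position \<open>k\<close>, keeps the border numbers of the left word, gives the maximum
  border number 0, and raises those of the right word by \<open>k\<close>.  The row lengths of the path satisfy the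
  same recursion, so both lists agree as multisets.  The nonzero border numbers are
  exactly the descents, and the letters with border number 0 are the left-to-right maxima.
\<close>

section \<open>Row lengths of a lattice path\<close>

text \<open>Unlike \<open>partition_above\<close>, this keeps the empty row of the first up step and
  the order along the path, which gives simple rules for \<open>#\<close> and
  \<open>@\<close>.\<close>

definition row_lengths :: "step list \<Rightarrow> nat list" where
  "row_lengths w = map (\<lambda>k. count_list (take k w) Rt) (filter (\<lambda>k. w ! k = Up) [0..<length w])"

lemma row_lengths_Nil [simp]: "row_lengths [] = []"
  by (simp add: row_lengths_def)

lemma row_lengths_Cons:
  "row_lengths (s # w) =
     (if s = Up then 0 # row_lengths w else map Suc (row_lengths w))"
proof -
  have "[0..<length (s # w)] = 0 # map Suc [0..<length w]"
    by (simp add: upt_conv_Cons map_Suc_upt del: upt_Suc)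
  moreover have "s = Up \<or> s = Rt"
    by (cases s) auto
  ultimately show ?thesis
    unfolding row_lengths_def by (auto simp: filter_map o_def simp del: upt_Suc)
qed

text \<open>Every right step of \<open>v\<close> precedes each up step of \<open>w\<close>, so it
  lengthens every row that starts in \<open>w\<close> by one.\<close>

lemma row_lengths_append:
  "row_lengths (v @ w) = row_lengths v @ map ((+) (count_list v Rt)) (row_lengths w)"
proof (induction v)
  case (Cons s v)
  then show ?case
    by (cases s) (simp_all add: row_lengths_Cons)
qed simp

lemma partition_above_row_lengths: "partition_above w = rev (tl (row_lengths w))"
  by (simp add: partition_above_def row_lengths_def)

section \<open>The recursion step of \<open>dyck\<close>, and standardization\<close>

text \<open>Packages one unfolding of \<open>dyck\<close>. The last two equations retain the terms
  of the recursive calls, so that the hypotheses of \<open>dyck.induct\<close> can be rewritten to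
  \<open>l\<close> and \<open>r\<close>.\<close>

lemma split_at_Max:
  assumes "p \<noteq> []" and "distinct p"
  obtains l m r where "p = l @ m # r" and "\<And>x. x \<in> set l \<union> set r \<Longrightarrow> x < m"
    and "dyck p = Up # dyck (standardization l) @ Rt # dyck (standardization r)"
    and "l = takeWhile (\<lambda>x. x \<noteq> Max (set p)) p"
    and "r = tl (dropWhile (\<lambda>x. x \<noteq> Max (set p)) p)"
proof -
  let ?P = "\<lambda>x. x \<noteq> Max (set p)"
  have "Max (set p) \<in> set p"
    using assms(1) by (intro Max_in) auto
  hence ne: "dropWhile ?P p \<noteq> []"
    by (auto simp: dropWhile_eq_Nil_conv)
  from hd_dropWhile[OF this] have "hd (dropWhile ?P p) = Max (set p)"
    by blast
  hence p: "p = takeWhile ?P p @ Max (set p) # tl (dropWhile ?P p)"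
    using ne takeWhile_dropWhile_id[of ?P p] by (cases "dropWhile ?P p") simp_all
  have "x < Max (set p)" if "x \<in> set (takeWhile ?P p) \<union> set (tl (dropWhile ?P p))" for x
  proof -
    have "x \<in> set p"
      by (subst p) (use that in auto)
    moreover have "distinct (takeWhile ?P p @ Max (set p) # tl (dropWhile ?P p))"
      using assms(2) p by simp
    hence "x \<noteq> Max (set p)"
      using that by auto
    ultimately show ?thesis
      by (simp add: order.not_eq_order_implies_strict)
  qed
  moreover have "dyck p = Up # dyck (standardization (takeWhile ?P p))
      @ Rt # dyck (standardization (tl (dropWhile ?P p)))"
    using assms(1) by (subst dyck.simps) simp
  ultimately show thesis
    using p that by blast
qed

lemma standardization_less_iff:
  assumes "x \<in> set w" and "y \<in> set w"
  shows "card {z \<in> set w. z \<le> x} < card {z \<in> set w. z \<le> (y::nat)} \<longleftrightarrow> x < y"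
proof
  assume "x < y"
  \<comment> \<open>The letter \<open>y\<close> is counted in its own rank but not in that of
    \<open>x\<close>, which makes the inclusion strict.\<close>
  hence "y \<in> {z \<in> set w. z \<le> y} - {z \<in> set w. z \<le> x}"
    and "{z \<in> set w. z \<le> x} \<subseteq> {z \<in> set w. z \<le> y}"
    using assms by auto
  hence "{z \<in> set w. z \<le> x} \<subset> {z \<in> set w. z \<le> y}"
    by blast
  thus "card {z \<in> set w. z \<le> x} < card {z \<in> set w. z \<le> y}"
    by (intro psubset_card_mono) auto
next
  assume less: "card {z \<in> set w. z \<le> x} < card {z \<in> set w. z \<le> y}"
  show "x < y"
  proof (rule ccontr)
    assume "\<not> x < y"
    hence "card {z \<in> set w. z \<le> y} \<le> card {z \<in> set w. z \<le> x}"
      by (intro card_mono) auto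
    with less show False
      by simp
  qed
qed

lemma distinct_standardization:
  assumes "distinct w"
  shows "distinct (standardization w)"
  unfolding standardization_def distinct_map
proof (intro conjI assms inj_onI)
  fix x y
  assume "x \<in> set w" and "y \<in> set w"
    and "card {z \<in> set w. z \<le> x} = card {z \<in> set w. z \<le> y}"
  thus "x = y"
    using standardization_less_iff[of x w y] standardization_less_iff[of y w x] by simp
qed

lemma letter_standardization_less_iff:
  assumes "i \<in> {1..length w}" and "j \<in> {1..length w}"
  shows "letter (standardization w) i < letter (standardization w) j \<longleftrightarrow> letter w i < letter w j"
  using assms by (auto simp: letter_def standardization_def standardization_less_iff)

text \<open>Border numbers depend only on the relative order of the letters, which standardization
  preserves.\<close>

lemma left_border_standardization:
  assumes "i \<in> {1..length w}"
  shows "left_border (standardization w) i = left_border w i"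
proof -
  have "{m \<in> {1..<i}. letter (standardization w) m > letter (standardization w) i}
      = {m \<in> {1..<i}. letter w m > letter w i}"
    using assms by (auto simp: letter_standardization_less_iff)
  thus ?thesis
    unfolding left_border_def by simp
qed

section \<open>Left border numbers under splitting at the maximum\<close>

lemma left_border_eqI:
  assumes "b = 0 \<or> b \<in> {1..<i} \<and> letter p i < letter p b"
    and "\<And>m. b < m \<Longrightarrow> m < i \<Longrightarrow> letter p m \<le> letter p i"
  shows "left_border p i = b"
  unfolding left_border_def
proof (rule Max_eqI)
  fix y
  assume "y \<in> insert 0 {m \<in> {1..<i}. letter p i < letter p m}"
  thus "y \<le> b"
    using assms(2)[of y] by force
qed (use assms(1) in auto)

lemma left_border_cases:
  "left_border p i = 0 \<or> left_border p i \<in> {1..<i} \<and> letter p i < letter p (left_border p i)"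
proof -
  have "left_border p i \<in> insert 0 {m \<in> {1..<i}. letter p i < letter p m}"
    unfolding left_border_def by (rule Max_in) auto
  thus ?thesis
    by auto
qed

lemma letter_le_of_left_border_less:
  assumes "left_border p i < m" and "m < i"
  shows "letter p m \<le> letter p i"
proof (rule ccontr)
  assume "\<not> letter p m \<le> letter p i"
  hence "m \<le> left_border p i"
    unfolding left_border_def using assms by (intro Max_ge) auto
  with assms show False
    by simp
qed

text \<open>Collected in a list, so that multiplicities survive the comparison with
  \<open>row_lengths\<close>.\<close>

definition left_borders :: "nat list \<Rightarrow> nat list" where
  "left_borders p = map (left_border p) [1..<Suc (length p)]"

lemma length_left_borders: "length (left_borders p) = length p"
  by (simp add: left_borders_def del: upt_Suc)

lemma left_borders_standardization [simp]: "left_borders (standardization w) = left_borders w"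
  by (simp add: left_borders_def left_border_standardization del: upt_Suc)

lemma letter_append_left:
  "i \<in> {1..length l} \<Longrightarrow> letter (l @ r) i = letter l i"
  by (auto simp: letter_def nth_append)

lemma letter_append_mid: "letter (l @ m # r) (Suc (length l)) = m"
  by (simp add: letter_def)

lemma letter_append_right:
  "j \<ge> 1 \<Longrightarrow> letter (l @ m # r) (Suc (length l) + j) = letter r j"
  by (cases j) (auto simp: letter_def nth_append)

lemma letter_in_set: "i \<in> {1..length p} \<Longrightarrow> letter p i \<in> set p"
  by (auto simp: letter_def)

lemma left_border_append_left:
  assumes "i \<in> {1..length l}"
  shows "left_border (l @ r) i = left_border l i"
proof -
  have "{m \<in> {1..<i}. letter (l @ r) m > letter (l @ r) i} = {m \<in> {1..<i}. letter l m > letter l i}"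
    using assms by (auto simp: letter_append_left)
  thus ?thesis
    unfolding left_border_def by simp
qed

lemma left_border_append_mid:
  assumes "\<And>x. x \<in> set l \<Longrightarrow> x < m"
  shows "left_border (l @ m # r) (Suc (length l)) = 0"
proof (rule left_border_eqI)
  fix k :: nat
  assume "0 < k" and "k < Suc (length l)"
  hence "k \<in> {1..length l}"
    by simp
  thus "letter (l @ m # r) k \<le> letter (l @ m # r) (Suc (length l))"
    using assms[OF letter_in_set] by (simp add: letter_append_left letter_append_mid less_imp_le)
qed simp

text \<open>If \<open>r\<close> has a larger letter to the left of position \<open>j\<close>, the
  last such letter stays the border. Otherwise the border is \<open>m\<close> itself, at position
  \<open>Suc (length l)\<close>; the formula covers this case because \<open>left_border r j\<close>
  is then 0.\<close>

lemma left_border_append_right: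
  assumes "j \<in> {1..length r}" and "\<And>x. x \<in> set r \<Longrightarrow> x < m"
  shows "left_border (l @ m # r) (Suc (length l) + j) = Suc (length l) + left_border r j"
proof (rule left_border_eqI)
  let ?k = "Suc (length l)"
  let ?b = "left_border r j"
  have j: "letter (l @ m # r) (?k + j) = letter r j"
    using assms(1) by (intro letter_append_right) simp
  have "letter (l @ m # r) (?k + j) < letter (l @ m # r) (?k + ?b) \<and> ?b < j"
  proof (cases "?b = 0")
    case True
    moreover have "letter r j < m"
      using assms letter_in_set by blast
    ultimately show ?thesis
      using j assms(1) letter_append_mid[of l m r] by simp
  next
    case False
    with left_border_cases[of r j] show ?thesis
      using j letter_append_right[of ?b l m r] by auto
  qed
  thus "?k + ?b = 0 \<or>
      ?k + ?b \<in> {1..<?k + j} \<and> letter (l @ m # r) (?k + j) < letter (l @ m # r) (?k + ?b)"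
    by simp
  fix x
  assume x: "?k + ?b < x" "x < ?k + j"
  define y where "y = x - ?k"
  have "x = ?k + y" "?b < y" "y < j"
    using x by (auto simp: y_def)
  thus "letter (l @ m # r) x \<le> letter (l @ m # r) (?k + j)"
    using j letter_append_right[of y l m r] letter_le_of_left_border_less[of r j y] by simp
qed

lemma left_borders_append_Max:
  assumes "\<And>x. x \<in> set l \<union> set r \<Longrightarrow> x < m"
  shows "left_borders (l @ m # r) =
    left_borders l @ 0 # map ((+) (Suc (length l))) (left_borders r)"
proof -
  let ?k = "Suc (length l)"
  let ?p = "l @ m # r"
  have "[1..<Suc (length ?p)] = [1..<?k] @ [?k..<?k + Suc (length r)]"
    using upt_add_eq_append[of 1 ?k "Suc (length r)"] by simp
  also have "[?k..<?k + Suc (length r)] = ?k # map ((+) ?k) [1..<Suc (length r)]"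
    by (intro nth_equalityI) (auto simp: nth_Cons simp del: upt_Suc split: nat.split)
  finally have split: "[1..<Suc (length ?p)] = [1..<?k] @ ?k # map ((+) ?k) [1..<Suc (length r)]" .
  have "map (left_border ?p) [1..<?k] = left_borders l"
    unfolding left_borders_def by (intro map_cong) (auto simp: left_border_append_left)
  moreover have "map (left_border ?p) (map ((+) ?k) [1..<Suc (length r)])
      = map ((+) ?k) (left_borders r)"
    unfolding left_borders_def map_map o_def
    using assms by (intro map_cong refl left_border_append_right) auto
  moreover have "left_border ?p ?k = 0"
    using assms by (intro left_border_append_mid) auto
  ultimately show ?thesis
    by (simp only: left_borders_def[of ?p] split map_append list.map)
qed

section \<open>Rows of the path versus left border numbers\<close>

text \<open>Each unfolding of \<open>dyck\<close> removes one letter and emits one right step. The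
  count supplies the amount by which the rows of the right subpath are shifted.\<close>

lemma count_list_dyck_Rt:
  assumes "distinct p"
  shows "count_list (dyck p) Rt = length p"
  using assms
proof (induction p rule: dyck.induct)
  case (1 p)
  show ?case
  proof (cases "p = []")
    case False
    from split_at_Max[OF this 1(3)] obtain l m r where s: "p = l @ m # r"
      "dyck p = Up # dyck (standardization l) @ Rt # dyck (standardization r)"
      "l = takeWhile (\<lambda>x. x \<noteq> Max (set p)) p" "r = tl (dropWhile (\<lambda>x. x \<noteq> Max (set p)) p)"
      by metis
    from s(1) 1(3) have "distinct l" "distinct r"
      by simp_all
    with 1(1,2)[OF False] have "count_list (dyck (standardization l)) Rt = length l"
      "count_list (dyck (standardization r)) Rt = length r"
      unfolding s(3,4)[symmetric] by (simp_all add: distinct_standardization)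
    thus ?thesis
      unfolding s(2) by (simp add: s(1))
  qed (simp add: dyck_Nil)
qed

text \<open>Only the order differs: the zero of the maximum stands between the two subwords in
  \<open>left_borders\<close>, while the opening up step puts its zero first in
  \<open>row_lengths\<close>.\<close>

lemma mset_row_lengths_dyck:
  assumes "distinct p"
  shows "mset (row_lengths (dyck p)) = mset (left_borders p)"
  using assms
proof (induction p rule: dyck.induct)
  case (1 p)
  show ?case
  proof (cases "p = []")
    case False
    from split_at_Max[OF this 1(3)] obtain l m r where s: "p = l @ m # r"
      "dyck p = Up # dyck (standardization l) @ Rt # dyck (standardization r)"
      "l = takeWhile (\<lambda>x. x \<noteq> Max (set p)) p" "r = tl (dropWhile (\<lambda>x. x \<noteq> Max (set p)) p)"
      and less: "\<And>x. x \<in> set l \<union> set r \<Longrightarrow> x < m"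
      by metis
    from s(1) 1(3) have d: "distinct l" "distinct r"
      by simp_all
    with 1(1,2)[OF False]
    have IH: "mset (row_lengths (dyck (standardization l))) = mset (left_borders l)"
      "mset (row_lengths (dyck (standardization r))) = mset (left_borders r)"
      unfolding s(3,4)[symmetric] by (simp_all add: distinct_standardization)
    \<comment> \<open>The rows of the right subpath are shifted by the \<open>length l\<close> right
      steps of the left subpath and by the \<open>Rt\<close> between the two; this is the form in
      which both shifts are composed.\<close>
    have shift: "(+) (Suc (length l)) = (\<lambda>x. Suc (length l + x))"
      by auto
    have "mset (row_lengths (dyck p)) = add_mset 0 (mset (row_lengths (dyck (standardization l)))
        + image_mset ((+) (Suc (length l))) (mset (row_lengths (dyck (standardization r)))))"
      unfolding s(2) using d
      by (simp add: row_lengths_Cons row_lengths_append count_list_dyck_Rt distinct_standardization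
          o_def shift)
    also have "\<dots> = mset (left_borders p)"
      using left_borders_append_Max[of l r m] less by (simp add: IH s(1))
    finally show ?thesis .
  qed (simp add: dyck_Nil left_borders_def)
qed

text \<open>The summand 0 is the row of the first up step, which is not a part.\<close>

lemma mset_Lam:
  assumes "distinct p" and "p \<noteq> []"
  shows "add_mset 0 (mset (Lam p)) = mset (left_borders p)"
proof -
  obtain w where "dyck p = Up # w"
    using assms(2) by (subst (asm) dyck.simps) simp
  hence "add_mset 0 (mset (Lam p)) = mset (row_lengths (dyck p))"
    by (simp add: Lam_def partition_above_row_lengths row_lengths_Cons)
  with mset_row_lengths_dyck[OF assms(1)] show ?thesis
    by simp
qed

section \<open>Descents and left-to-right maxima from border numbers\<close>

text \<open>If \<open>b\<close> is the nonzero border of \<open>i\<close>, then the letter at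
  \<open>b\<close> exceeds that at \<open>i\<close>, which is at least the one at
  \<open>b + 1\<close>; so \<open>b\<close> is a descent. Conversely, a descent \<open>b\<close> is
  the border of \<open>b + 1\<close>.\<close>

lemma nonzero_left_borders: "set (left_borders p) - {0} = descents p"
proof (intro equalityI subsetI)
  fix b
  assume "b \<in> set (left_borders p) - {0}"
  then obtain i where i: "i \<in> {1..length p}" "b = left_border p i" "b \<noteq> 0"
    by (auto simp: left_borders_def atLeastLessThanSuc_atLeastAtMost simp del: upt_Suc)
  with left_border_cases[of p i] have b: "b \<in> {1..<i}" "letter p i < letter p b"
    by auto
  have "letter p (b + 1) \<le> letter p i"
    using letter_le_of_left_border_less[of p i "b + 1"] i(2) b(1) by (cases "b + 1 = i") auto
  with b i(1) show "b \<in> descents p"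
    by (auto simp: descents_def)
next
  fix b
  assume b: "b \<in> descents p"
  hence "left_border p (b + 1) = b"
    by (intro left_border_eqI) (auto simp: descents_def)
  moreover have "b + 1 \<in> {1..<Suc (length p)}"
    using b by (auto simp: descents_def)
  ultimately show "b \<in> set (left_borders p) - {0}"
    using b unfolding left_borders_def descents_def by (force simp del: upt_Suc)
qed

lemma left_border_eq_0_iff:
  assumes "distinct p" and "i \<in> {1..length p}"
  shows "left_border p i = 0 \<longleftrightarrow> (\<forall>j \<in> {1..<i}. letter p j < letter p i)"
proof
  assume zero: "left_border p i = 0"
  show "\<forall>j \<in> {1..<i}. letter p j < letter p i"
  proof
    fix j
    assume j: "j \<in> {1..<i}"
    \<comment> \<open>A zero border yields only a weak inequality; distinctness makes it
      strict.\<close>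
    hence "letter p j \<noteq> letter p i"
      using assms by (auto simp: letter_def nth_eq_iff_index_eq)
    moreover have "letter p j \<le> letter p i"
      using j zero by (intro letter_le_of_left_border_less) auto
    ultimately show "letter p j < letter p i"
      by simp
  qed
next
  assume "\<forall>j \<in> {1..<i}. letter p j < letter p i"
  thus "left_border p i = 0"
    by (intro left_border_eqI) (auto simp: less_imp_le)
qed

lemma length_filter_nonzero_left_borders:
  assumes "distinct p"
  shows "length (filter (\<lambda>x. x \<noteq> 0) (left_borders p)) + lrmax p = length p"
proof -
  \<comment> \<open>Counting entries of the list becomes counting positions, since the positions
    listed are distinct.\<close>
  have "length (filter (\<lambda>x. x = 0) (left_borders p))
      = card (set (filter (\<lambda>i. left_border p i = 0) [1..<Suc (length p)]))"
    by (subst distinct_card) (simp_all add: left_borders_def filter_map o_def del: upt_Suc)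
  also have "set (filter (\<lambda>i. left_border p i = 0) [1..<Suc (length p)])
      = {i \<in> {1..length p}. \<forall>j \<in> {1..<i}. letter p j < letter p i}"
    using left_border_eq_0_iff[OF assms] by auto
  finally have "length (filter (\<lambda>x. x = 0) (left_borders p)) = lrmax p"
    by (simp add: lrmax_def)
  thus ?thesis
    using sum_length_filter_compl[of "\<lambda>x. x = 0" "left_borders p"]
    by (simp add: length_left_borders)
qed

lemma sum_list_left_borders: "sum_list (left_borders p) = lbsum p"
  by (simp add: left_borders_def lbsum_def sum_list_distinct_conv_sum_set
      atLeastLessThanSuc_atLeastAtMost del: upt_Suc)

theorem corollary1p5:
  fixes n :: nat and p :: "nat list"
  assumes "n \<ge> 1" and "p \<in> permutations_of_set {1..n}"
  shows "card {x \<in> set (Lam p). x \<noteq> 0} = des p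
    \<and> int (length (filter (\<lambda>x. x \<noteq> 0) (Lam p))) = int n - int (lrmax p)
    \<and> largest_part (Lam p) = largest_descent p
    \<and> \<Sum>(set (Lam p)) = maj p
    \<and> sum_list (Lam p) = lbsum p"
proof -
  have d: "distinct p" and s: "set p = {1..n}"
    using assms(2) by (simp_all add: permutations_of_set_def)
  have len: "length p = n"
    using distinct_card[OF d] s by simp
  with assms(1) have "p \<noteq> []"
    by auto
  note Lam = mset_Lam[OF d this]
  have "set (left_borders p) = insert 0 (set (Lam p))"
    using arg_cong[OF Lam, of set_mset] by simp
  \<comment> \<open>Deleting 0 cancels the adjoined zero, whether or not 0 is also a part.\<close>
  hence nonzero: "set (Lam p) - {0} = descents p"
    using nonzero_left_borders[of p] by simp
  hence "card {x \<in> set (Lam p). x \<noteq> 0} = des p"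
    by (simp add: des_def set_diff_eq)
  moreover have "int (length (filter (\<lambda>x. x \<noteq> 0) (Lam p))) = int n - int (lrmax p)"
  proof -
    have "length (filter (\<lambda>x. x \<noteq> 0) (Lam p)) = length (filter (\<lambda>x. x \<noteq> 0) (left_borders p))"
      using arg_cong[OF Lam, of "\<lambda>M. size (filter_mset (\<lambda>x. x \<noteq> 0) M)"]
      by (simp flip: mset_filter)
    with length_filter_nonzero_left_borders[OF d] len show ?thesis
      by simp
  qed
  moreover have "largest_part (Lam p) = largest_descent p"
    \<comment> \<open>Both maxima adjoin 0, so deleting 0 from the parts does not affect
      them.\<close>
    unfolding largest_part_def largest_descent_def nonzero[symmetric] by simp
  moreover have "\<Sum>(set (Lam p)) = maj p"
    unfolding maj_def nonzero[symmetric] by (simp add: sum_diff1_nat)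
  moreover have "sum_list (Lam p) = lbsum p"
    \<comment> \<open>The adjoined zero adds nothing to the sum.\<close>
    using arg_cong[OF Lam, of sum_mset] sum_list_left_borders[of p] by (simp add: sum_mset_sum_list)
  ultimately show ?thesis
    by blast
qed

end
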